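(* Let $\mathcal P$ be a set of probability measures on a measurable space $(\mathcal X,\mathcal F)$ and $\theta:\mathcal P\to\mathbb R$. Let $l:[0,\infty)\to[0,\infty)$ be a non-decreasing loss function with $l(0)=0$ and $l(\frac32t)\le a\,l(t)$ for every $t\ge0$, for some $a\in(1,\infty)$. Suppose that $\mathcal P$ and $\theta$ are such that there exist $k\in\mathbb N$, $t\in(0,\infty)^k$, $s\in[0,\infty)^k$, $D_0\in(0,\infty)$, $h_0\in(0,1]$ and a class of measurable functions $\ell_h:\mathcal X\to\mathbb R$ indexed by $h\in\mathbb R^k$, such that for all $h\in(0,h_0]^k$, $$\|\ell_h\|_\infty\le D_0\prod_{j=1}^kh_j^{-s_j}\qquad\text{and}\qquad \sup_{P\in\mathcal P}\left|\mathbb E_P[\ell_h]-\theta(P)\right|\le D_0\,\frac1k\sum_{j=1}^kh_j^{t_j}.$$ Set $\bar r=\sum_{j=1}^k\frac{s_j}{t_j}$. For $\alpha\in(0,\infty)$, let $Q^{(\alpha,\ell)}$ be the non-interactive $\alpha$-private channel with identical binary marginals $Q_1^{(\alpha,\ell)}$ defined in the context, and set $h_n=(h_{n,1},\dots,h_{n,k})^T$ with $$h_{n,j}=\left(\frac{1}{\sqrt n}\,\frac{e^\alpha+1}{e^\alpha-1}\right)^{\frac{1}{t_j(1+\bar r)}}.$$ Then the arithmetic mean $\bar Z_n(z)=\frac1n\sum_{i=1}^nz_i$, $z=(z_1,\dots,z_n)'\in\mathbb R^n$, satisfies $$\sup_{P\in\mathcal P}\mathbb E_{Q^{(\alpha,\ell_{h_n})}P^{\otimes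 n}}\left[l(|\bar Z_n-\theta(P)|)\right]\;\le\; C_0\cdot l\left(\left(\frac{1}{\sqrt n}\,\frac{e^\alpha+1}{e^\alpha-1}\right)^{\frac{1}{1+\bar r}}\right),$$ for all $n\in\mathbb N$ and a positive finite constant $C_0$ that depends only on $a$ and $D_0$.
   Context: Binary channel: for a bounded measurable $\ell:\mathcal X\to\mathbb R$ and $z_0=\|\ell\|_\infty\frac{e^\alpha+1}{e^\alpha-1}$ (sup norm), $Q_1^{(\alpha,\ell)}$ is the Markov kernel from $\mathcal X$ to $\{-z_0,z_0\}\subset\mathbb R$ given by $Q_1^{(\alpha,\ell)}(\{\pm z_0\}|x)=\frac12\big(1\pm\frac{\ell(x)}{z_0}\big)$. The channel $Q^{(\alpha,\ell)}$ from $\mathcal X^n$ to $\mathbb R^n$ is the product kernel $Q^{(\alpha,\ell)}(A_1\times\dots\times A_n|x_1,\dots,x_n)=\prod_{i=1}^nQ_1^{(\alpha,\ell)}(A_i|x_i)$. It is $\alpha$-private, meaning $Q_1^{(\alpha,\ell)}(A|x)\le e^\alpha Q_1^{(\alpha,\ell)}(A|x')$ for all Borel sets $A$ and all $x,x'\in\mathcal X$. $P^{\otimes n}$ is the $n$-fold product measure of $P$, and $QP^{\otimes n}$ denotes the measure $A\mapsto\int Q(A|x)\,dP^{\otimes n}(x)$.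
   Formalization: The bound is proved for those n with h_n in (0,h_0]^k rather than for all n: the hypotheses do not constrain ell_h elsewhere and the claim fails there. C_0 is formally chosen per type of the sample space; a pushforward to the reals makes one constant serve all. *)

theory Defs
  imports "HOL-Probability.Probability"
begin

text \<open>
  The supremum norm over the sample space is taken in the extended nonnegative reals, so that it is
  infinite for an unbounded function and a bound by a real number entails boundedness.
\<close>

definition sup_norm :: "'x measure \<Rightarrow> ('x \<Rightarrow> real) \<Rightarrow> ennreal" where
  "sup_norm M f = (SUP x\<in>space M. ennreal \<bar>f x\<bar>)"

definition channel_level :: "'x measure \<Rightarrow> real \<Rightarrow> ('x \<Rightarrow> real) \<Rightarrow> real" where
  "channel_level M \<alpha> f = enn2real (sup_norm M f) * ((exp \<alpha> + 1) / (exp \<alpha> - 1))"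

text \<open>
  The law, as a measure on the Borel sets of the real line, that puts mass
  \<open>(1 + f x / z\<^sub>0) / 2\<close> on \<open>z\<^sub>0\<close> and the remaining mass on \<open>-z\<^sub>0\<close>.
  If \<open>f\<close> vanishes identically, then \<open>z\<^sub>0 = 0\<close> and this is the point mass at \<open>0\<close>.
\<close>

definition binary_channel :: "'x measure \<Rightarrow> real \<Rightarrow> ('x \<Rightarrow> real) \<Rightarrow> 'x \<Rightarrow> real measure" where
  "binary_channel M \<alpha> f x =
     (let z\<^sub>0 = channel_level M \<alpha> f in
      distr (measure_pmf (bernoulli_pmf ((1 + f x / z\<^sub>0) / 2))) borel (\<lambda>b. if b then z\<^sub>0 else - z\<^sub>0))"

definition product_channel ::
  "'x measure \<Rightarrow> real \<Rightarrow> ('x \<Rightarrow> real) \<Rightarrow> nat \<Rightarrow> (nat \<Rightarrow> 'x) \<Rightarrow> (nat \<Rightarrow> real) measure" where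
  "product_channel M \<alpha> f n x = Pi\<^sub>M {1..n} (\<lambda>i. binary_channel M \<alpha> f (x i))"

text \<open>
  The measure \<open>QP\<^sup>n\<close> on the n-dimensional space of functions on \<open>{1..n}\<close>; the identity
  \<open>QP\<^sup>n(A) = \<integral> Q(A | x) dP\<^sup>n(x)\<close> is lemma \<open>emeasure_privatized\<close> below.
\<close>

definition privatized ::
  "'x measure \<Rightarrow> real \<Rightarrow> ('x \<Rightarrow> real) \<Rightarrow> nat \<Rightarrow> 'x measure \<Rightarrow> (nat \<Rightarrow> real) measure" where
  "privatized M \<alpha> f n P = Pi\<^sub>M {1..n} (\<lambda>_. P) \<bind> product_channel M \<alpha> f n"

definition arith_mean :: "nat \<Rightarrow> (nat \<Rightarrow> real) \<Rightarrow> real" where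
  "arith_mean n z = (1 / real n) * (\<Sum>i=1..n. z i)"

definition exponent_ratio :: "nat \<Rightarrow> (nat \<Rightarrow> real) \<Rightarrow> (nat \<Rightarrow> real) \<Rightarrow> real" where
  "exponent_ratio k t s = (\<Sum>j=1..k. s j / t j)"

definition private_scale :: "real \<Rightarrow> nat \<Rightarrow> real" where
  "private_scale \<alpha> n = 1 / sqrt (real n) * ((exp \<alpha> + 1) / (exp \<alpha> - 1))"

text \<open>
  Vectors in k-dimensional space are functions on \<open>{1..k}\<close>, extended by \<open>undefined\<close>
  (elements of \<open>\<Pi>\<^sub>E\<close>).
\<close>

definition bandwidth ::
  "nat \<Rightarrow> (nat \<Rightarrow> real) \<Rightarrow> (nat \<Rightarrow> real) \<Rightarrow> real \<Rightarrow> nat \<Rightarrow> nat \<Rightarrow> real" where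
  "bandwidth k t s \<alpha> n =
     (\<lambda>j\<in>{1..k}. private_scale \<alpha> n powr (1 / (t j * (1 + exponent_ratio k t s))))"


text \<open>Well-definedness of the channel, its point masses, and privacy.\<close>

lemma abs_le_sup_norm:
  assumes "sup_norm M f < \<infinity>" "x \<in> space M"
  shows "\<bar>f x\<bar> \<le> enn2real (sup_norm M f)"
proof -
  have "ennreal \<bar>f x\<bar> \<le> sup_norm M f"
    unfolding sup_norm_def using assms(2) by (rule SUP_upper)
  then have "enn2real (ennreal \<bar>f x\<bar>) \<le> enn2real (sup_norm M f)"
    using assms(1) by (intro enn2real_mono) auto
  then show ?thesis by simp
qed

lemma channel_ratio_bound:
  assumes "sup_norm M f < \<infinity>" "0 < \<alpha>" "x \<in> space M"
  shows "\<bar>f x / channel_level M \<alpha> f\<bar> \<le> (exp \<alpha> - 1) / (exp \<alpha> + 1)"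
proof -
  let ?N = "enn2real (sup_norm M f)"
  have e: "exp \<alpha> > 1" using assms(2) by simp
  have b: "\<bar>f x\<bar> \<le> ?N" using abs_le_sup_norm[OF assms(1,3)] .
  show ?thesis
  proof (cases "?N = 0")
    case True
    then show ?thesis using b e by simp
  next
    case False
    then have N: "?N > 0" by (simp add: less_le)
    have "channel_level M \<alpha> f \<ge> 0"
      unfolding channel_level_def using N e by (intro mult_nonneg_nonneg divide_nonneg_nonneg) auto
    then have "\<bar>f x / channel_level M \<alpha> f\<bar> = \<bar>f x\<bar> / channel_level M \<alpha> f"
      by (simp only: abs_divide abs_of_nonneg)
    also have "\<dots> = \<bar>f x\<bar> / ?N * ((exp \<alpha> - 1) / (exp \<alpha> + 1))"
      unfolding channel_level_def by simp
    also have "\<dots> \<le> 1 * ((exp \<alpha> - 1) / (exp \<alpha> + 1))"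
      using N b e by (intro mult_right_mono) auto
    finally show ?thesis by simp
  qed
qed

lemma channel_ratio_le_1:
  assumes "sup_norm M f < \<infinity>" "0 < \<alpha>" "x \<in> space M"
  shows "\<bar>f x / channel_level M \<alpha> f\<bar> \<le> 1"
proof -
  have "(exp \<alpha> - 1) / (exp \<alpha> + 1) \<le> 1" by (simp add: divide_le_eq add_pos_pos)
  then show ?thesis using channel_ratio_bound[OF assms] by linarith
qed

lemma emeasure_binary_channel:
  assumes "sup_norm M f < \<infinity>" "0 < \<alpha>" "x \<in> space M" "A \<in> sets borel"
  defines "z\<^sub>0 \<equiv> channel_level M \<alpha> f"
  shows "emeasure (binary_channel M \<alpha> f x) A =
    ennreal ((1 + f x / z\<^sub>0) / 2) * indicator A z\<^sub>0 + ennreal ((1 - f x / z\<^sub>0) / 2) * indicator A (- z\<^sub>0)"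
proof -
  have r: "\<bar>f x / z\<^sub>0\<bar> \<le> 1"
    unfolding z\<^sub>0_def by (rule channel_ratio_le_1[OF assms(1-3)])
  let ?p = "(1 + f x / z\<^sub>0) / 2"
  have "0 \<le> ?p" "?p \<le> 1" using abs_le_D1[OF r] abs_le_D2[OF r] by auto
  then have p: "?p \<in> {0..1}" by simp
  have "emeasure (binary_channel M \<alpha> f x) A =
      (\<integral>\<^sup>+b. indicator A (if b then z\<^sub>0 else - z\<^sub>0) \<partial>measure_pmf (bernoulli_pmf ?p))"
    unfolding binary_channel_def Let_def z\<^sub>0_def[symmetric]
    using assms(4)
    by (simp add: nn_integral_distr flip: nn_integral_indicator)
  also have "\<dots> = ennreal ?p * indicator A z\<^sub>0 + ennreal (1 - ?p) * indicator A (- z\<^sub>0)"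
    using p by (simp add: nn_integral_bernoulli_pmf mult.commute)
  also have "1 - ?p = (1 - f x / z\<^sub>0) / 2" by (simp add: field_simps)
  finally show ?thesis .
qed

lemma measure_binary_channel_points:
  assumes "sup_norm M f < \<infinity>" "0 < \<alpha>" "x \<in> space M" "channel_level M \<alpha> f \<noteq> 0"
  defines "z\<^sub>0 \<equiv> channel_level M \<alpha> f"
  shows "measure (binary_channel M \<alpha> f x) {z\<^sub>0} = (1 + f x / z\<^sub>0) / 2"
    and "measure (binary_channel M \<alpha> f x) {- z\<^sub>0} = (1 - f x / z\<^sub>0) / 2"
proof -
  have "\<bar>f x / z\<^sub>0\<bar> \<le> 1"
    unfolding z\<^sub>0_def by (rule channel_ratio_le_1[OF assms(1-3)])
  from abs_le_D1[OF this] abs_le_D2[OF this]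
  have r: "(1 + f x / z\<^sub>0) / 2 \<ge> 0" "(1 - f x / z\<^sub>0) / 2 \<ge> 0" by auto
  have z: "z\<^sub>0 \<noteq> - z\<^sub>0" "- z\<^sub>0 \<noteq> z\<^sub>0" using assms(4) unfolding z\<^sub>0_def by auto
  note E = emeasure_binary_channel[OF assms(1-3), folded z\<^sub>0_def]
  show "measure (binary_channel M \<alpha> f x) {z\<^sub>0} = (1 + f x / z\<^sub>0) / 2"
    unfolding measure_def by (subst E) (use z r in \<open>simp_all add: indicator_def\<close>)
  show "measure (binary_channel M \<alpha> f x) {- z\<^sub>0} = (1 - f x / z\<^sub>0) / 2"
    unfolding measure_def by (subst E) (use z r in \<open>simp_all add: indicator_def\<close>)
qed

lemma sets_binary_channel [simp, measurable_cong]: "sets (binary_channel M \<alpha> f x) = sets borel"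
  by (simp add: binary_channel_def Let_def)

lemma space_binary_channel [simp]: "space (binary_channel M \<alpha> f x) = UNIV"
  by (simp add: binary_channel_def Let_def)

lemma prob_space_binary_channel: "prob_space (binary_channel M \<alpha> f x)"
  unfolding binary_channel_def Let_def
  by (intro prob_space.prob_space_distr measure_pmf.prob_space_axioms) simp

lemma measurable_binary_channel:
  assumes "f \<in> borel_measurable M" "sup_norm M f < \<infinity>" "0 < \<alpha>"
  shows "binary_channel M \<alpha> f \<in> M \<rightarrow>\<^sub>M prob_algebra borel"
proof (rule measurable_prob_algebraI)
  show "prob_space (binary_channel M \<alpha> f x)" for x by (rule prob_space_binary_channel)
  show "binary_channel M \<alpha> f \<in> M \<rightarrow>\<^sub>M subprob_algebra borel"
  proof (rule measurable_subprob_algebra)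
    show "subprob_space (binary_channel M \<alpha> f x)" for x
      using prob_space_binary_channel by (rule prob_space_imp_subprob_space)
    fix A :: "real set" assume A: "A \<in> sets borel"
    note [measurable] = assms(1)
    show "(\<lambda>x. emeasure (binary_channel M \<alpha> f x) A) \<in> borel_measurable M"
      by (subst measurable_cong[OF emeasure_binary_channel[OF assms(2,3) _ A]]) simp_all
  qed simp
qed

lemma binary_channel_private:
  assumes "sup_norm M f < \<infinity>" "0 < \<alpha>" "x \<in> space M" "x' \<in> space M" "A \<in> sets borel"
  shows "emeasure (binary_channel M \<alpha> f x) A \<le> ennreal (exp \<alpha>) * emeasure (binary_channel M \<alpha> f x') A"
proof -
  define e where "e = exp \<alpha>"
  let ?z = "channel_level M \<alpha> f"
  define u where "u = f x / ?z"
  define v where "v = f x' / ?z"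
  have e: "e > 1" using assms(2) by (simp add: e_def)
  have "\<bar>u\<bar> \<le> (e - 1) / (e + 1)" "\<bar>v\<bar> \<le> (e - 1) / (e + 1)"
    unfolding u_def v_def e_def
    using channel_ratio_bound[OF assms(1,2)] assms(3,4) by blast+
  moreover have c: "1 + (e - 1) / (e + 1) = e * (1 - (e - 1) / (e + 1))"
    using e by (simp add: field_simps)
  ultimately have uv: "1 + u \<le> e * (1 + w)" "1 - u \<le> e * (1 + w)" if "w = v \<or> w = - v" for w
  proof -
    assume uv: "\<bar>u\<bar> \<le> (e - 1) / (e + 1)" "\<bar>v\<bar> \<le> (e - 1) / (e + 1)"
    have "e * (1 - (e - 1) / (e + 1)) \<le> e * (1 + w)"
      using e uv that by (intro mult_left_mono) auto
    then show "1 + u \<le> e * (1 + w)" "1 - u \<le> e * (1 + w)" using uv c by auto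
  qed
  have 1: "ennreal ((1 + u) / 2) \<le> ennreal e * ennreal ((1 + v) / 2)"
    using uv(1)[of "v"] e by (subst ennreal_mult'[symmetric]) (auto intro!: ennreal_leI)
  have 2: "ennreal ((1 - u) / 2) \<le> ennreal e * ennreal ((1 - v) / 2)"
    using uv(2)[of "- v"] e by (subst ennreal_mult'[symmetric]) (auto intro!: ennreal_leI)
  have "ennreal ((1 + u) / 2) * indicator A ?z + ennreal ((1 - u) / 2) * indicator A (- ?z)
    \<le> (ennreal e * ennreal ((1 + v) / 2)) * indicator A ?z
      + (ennreal e * ennreal ((1 - v) / 2)) * indicator A (- ?z)"
    by (intro add_mono mult_right_mono 1 2) auto
  then show ?thesis
    using emeasure_binary_channel[OF assms(1,2,3,5)] emeasure_binary_channel[OF assms(1,2,4,5)]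
    unfolding u_def v_def e_def by (simp add: distrib_left mult.assoc)
qed

lemma prob_space_product_channel: "prob_space (product_channel M \<alpha> f n x)"
  unfolding product_channel_def by (intro prob_space_PiM prob_space_binary_channel)

lemma sets_product_channel [simp, measurable_cong]:
  "sets (product_channel M \<alpha> f n x) = sets (Pi\<^sub>M {1..n} (\<lambda>_. borel))"
  unfolding product_channel_def by (intro sets_PiM_cong) simp_all

lemma emeasure_product_channel:
  assumes "\<And>i. i \<in> {1..n} \<Longrightarrow> A i \<in> sets borel"
  shows "emeasure (product_channel M \<alpha> f n x) (Pi\<^sub>E {1..n} A) =
    (\<Prod>i=1..n. emeasure (binary_channel M \<alpha> f (x i)) (A i))"
proof -
  interpret product_prob_space "\<lambda>i. binary_channel M \<alpha> f (x i)" "{1..n}"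
    by (rule product_prob_spaceI) (rule prob_space_binary_channel)
  show ?thesis unfolding product_channel_def by (rule emeasure_PiM) (use assms in auto)
qed

lemma measurable_product_channel:
  assumes "f \<in> borel_measurable M" "sup_norm M f < \<infinity>" "0 < \<alpha>"
  shows "product_channel M \<alpha> f n \<in> Pi\<^sub>M {1..n} (\<lambda>_. M) \<rightarrow>\<^sub>M prob_algebra (Pi\<^sub>M {1..n} (\<lambda>_. borel))"
proof (rule measurable_prob_algebra_generated)
  show "sets (Pi\<^sub>M {1..n} (\<lambda>_. borel :: real measure)) =
    sigma_sets (\<Pi>\<^sub>E i\<in>{1..n}. space borel) (prod_algebra {1..n} (\<lambda>_. borel))"
    by (rule sets_PiM)
  show "Int_stable (prod_algebra {1..n} (\<lambda>_. borel :: real measure))"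
    by (rule Int_stable_prod_algebra)
  show "prod_algebra {1..n} (\<lambda>_. borel :: real measure) \<subseteq> Pow (\<Pi>\<^sub>E i\<in>{1..n}. space borel)"
    by (rule prod_algebra_sets_into_space)
  show "prob_space (product_channel M \<alpha> f n x)" for x by (rule prob_space_product_channel)
  show "sets (product_channel M \<alpha> f n x) = sets (Pi\<^sub>M {1..n} (\<lambda>_. borel))" for x by simp
  fix B :: "(nat \<Rightarrow> real) set" assume "B \<in> prod_algebra {1..n} (\<lambda>_. borel)"
  then obtain A where B: "B = Pi\<^sub>E {1..n} A" and A: "A \<in> (\<Pi> i\<in>{1..n}. sets borel)"
    by (rule prod_algebraE_all)
  have [measurable]: "(\<lambda>x. emeasure (binary_channel M \<alpha> f x) (A i)) \<in> borel_measurable M"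
    if "i \<in> {1..n}" for i
  proof (rule measurable_emeasure_kernel)
    show "binary_channel M \<alpha> f \<in> M \<rightarrow>\<^sub>M subprob_algebra borel"
      by (rule measurable_prob_algebraD) (rule measurable_binary_channel[OF assms])
    show "A i \<in> sets borel" using A that by auto
  qed
  have "emeasure (product_channel M \<alpha> f n x) B =
      (\<Prod>i=1..n. emeasure (binary_channel M \<alpha> f (x i)) (A i))" for x
    unfolding B by (rule emeasure_product_channel) (use A in auto)
  then show "(\<lambda>x. emeasure (product_channel M \<alpha> f n x) B) \<in> borel_measurable (Pi\<^sub>M {1..n} (\<lambda>_. M))"
    by simp measurable
qed

lemma emeasure_privatized:
  assumes "f \<in> borel_measurable M" "sup_norm M f < \<infinity>" "0 < \<alpha>"
    and "P \<in> space (prob_algebra M)" "A \<in> sets (Pi\<^sub>M {1..n} (\<lambda>_. borel))"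
  shows "emeasure (privatized M \<alpha> f n P) A =
    (\<integral>\<^sup>+x. emeasure (product_channel M \<alpha> f n x) A \<partial>Pi\<^sub>M {1..n} (\<lambda>_. P))"
  unfolding privatized_def
proof (rule emeasure_bind)
  have P: "sets P = sets M" "prob_space P" using assms(4) by (auto simp: space_prob_algebra)
  have "prob_space (Pi\<^sub>M {1..n} (\<lambda>_. P))" by (intro prob_space_PiM P)
  then show "space (Pi\<^sub>M {1..n} (\<lambda>_. P)) \<noteq> {}" by (rule prob_space.not_empty)
  have "product_channel M \<alpha> f n \<in>
      Pi\<^sub>M {1..n} (\<lambda>_. M) \<rightarrow>\<^sub>M subprob_algebra (Pi\<^sub>M {1..n} (\<lambda>_. borel))"
    by (rule measurable_prob_algebraD) (rule measurable_product_channel[OF assms(1-3)])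
  moreover have "sets (Pi\<^sub>M {1..n} (\<lambda>_. P)) = sets (Pi\<^sub>M {1..n} (\<lambda>_. M))"
    by (intro sets_PiM_cong P refl)
  ultimately show "product_channel M \<alpha> f n \<in>
      Pi\<^sub>M {1..n} (\<lambda>_. P) \<rightarrow>\<^sub>M subprob_algebra (Pi\<^sub>M {1..n} (\<lambda>_. borel))"
    by (simp cong: measurable_cong_sets)
qed (rule assms(5))

end

theory Submission
  imports Defs
begin

text \<open>
  Put \<open>\<psi> = private_scale \<alpha> n powr (1 / (1 + r))\<close>, with \<open>r\<close> the exponent ratio. The bandwidth
  is chosen so that the bias of the estimator is at most \<open>D\<^sub>0 * \<psi>\<close> and the channel level is at
  most \<open>D\<^sub>0 * sqrt n * \<psi>\<close>. Under the privatized law the observations are i.i.d. and bounded by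
  the channel level, so by Hoeffding's lemma the centred mean divided by \<open>\<psi>\<close> is sub-Gaussian
  with variance proxy \<open>D\<^sub>0\<^sup>2\<close>. The growth condition gives
  \<open>l (y * \<psi>) \<le> a * exp (c * y) * l \<psi>\<close> with \<open>c = 2 * ln a\<close>, and this exponential envelope
  turns the risk bound into a bound on two moment generating functions.
\<close>

section \<open>Exponential envelope for the loss\<close>

text \<open>Shrinking the argument by \<open>2 / 3\<close> costs a factor \<open>a\<close>, and
  about log \<open>y\<close> shrinkings bring \<open>y\<close> into [0, 1], where monotonicity
  applies. The true growth is thus polynomial in \<open>y\<close>; the cruder exponential form is
  chosen because it can be integrated by moment generating functions. The induction is on the number
  \<open>m\<close> of shrinkings.\<close>

lemma doubling_growth_exp:
  fixes l :: "real \<Rightarrow> real"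
  assumes a: "1 < a" and l: "l \<in> {0..} \<rightarrow> {0..}" "mono_on {0..} l"
    and growth: "\<forall>u\<ge>0. l (3 / 2 * u) \<le> a * l u"
    and \<psi>: "0 \<le> \<psi>" and y: "0 \<le> y"
  shows "l (y * \<psi>) \<le> a * exp (2 * ln a * y) * l \<psi>"
proof -
  have lpos: "0 \<le> l u" if "0 \<le> u" for u
    using l(1) that by auto
  have small: "l (y * \<psi>) \<le> l \<psi>" if "0 \<le> y" "y \<le> 1" for y
    using that \<psi> by (intro mono_onD[OF l(2)]) (auto intro: mult_left_le_one_le)
  have "l (y * \<psi>) \<le> a * exp (2 * ln a * y) * l \<psi>" if "0 \<le> y" "y \<le> (3 / 2) ^ m" for m y
    using that
  proof (induction m arbitrary: y)
    case 0
    have "1 * 1 \<le> a * exp (2 * ln a * y)"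
      using a 0 by (intro mult_mono) auto
    then have "1 * l \<psi> \<le> a * exp (2 * ln a * y) * l \<psi>"
      using lpos[OF \<psi>] by (intro mult_right_mono) auto
    then show ?case using small[of y] 0 by simp
  next
    case (Suc m)
    define x where "x = 2 / 3 * y"
    have x: "0 \<le> x" "x \<le> (3 / 2) ^ m" "3 / 2 * (x * \<psi>) = y * \<psi>"
      using Suc.prems by (auto simp: x_def)
    have step: "l (y * \<psi>) \<le> a * l (x * \<psi>)"
      using growth[rule_format, of "x * \<psi>"] x(1) \<psi> unfolding x(3) by simp
    show ?case
    \<comment> \<open>The step that lands in [0, 1] is paid for by the prefactor \<open>a\<close>;
      every earlier one is absorbed by the growth of the exponential.\<close>
    proof (cases "x \<le> 1")
      case True
      have "a * l (x * \<psi>) \<le> a * l \<psi>"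
        using small[OF x(1) True] a by simp
      moreover have "a * 1 * l \<psi> \<le> a * exp (2 * ln a * y) * l \<psi>"
        using a Suc.prems lpos[OF \<psi>] by (intro mult_right_mono mult_left_mono) auto
      ultimately show ?thesis using step by simp
    next
      case False
      \<comment> \<open>Since \<open>y = 3 / 2 * x\<close> and \<open>x > 1\<close>, the gap
        \<open>y - x = x / 2\<close> exceeds 1/2. This is where the rate \<open>2 * ln a\<close>
        comes from: over such a gap the exponential gains at least the factor
        \<open>a\<close>.\<close>
      have "ln a * 1 \<le> ln a * (2 * (y - x))"
        using False a by (intro mult_left_mono) (auto simp: x_def)
      then have "exp (ln a) \<le> exp (2 * ln a * (y - x))" by (simp add: algebra_simps)
      then have "a \<le> exp (2 * ln a * (y - x))" using a by simp
      then have "a * exp (2 * ln a * x) \<le> exp (2 * ln a * (y - x)) * exp (2 * ln a * x)"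
        by (intro mult_right_mono) auto
      also have "\<dots> = exp (2 * ln a * y)"
        by (simp add: algebra_simps flip: exp_add)
      finally have "a * (a * exp (2 * ln a * x)) * l \<psi> \<le> a * exp (2 * ln a * y) * l \<psi>"
        using a lpos[OF \<psi>] by (intro mult_right_mono mult_left_mono) auto
      moreover have "a * l (x * \<psi>) \<le> a * (a * exp (2 * ln a * x) * l \<psi>)"
        using Suc.IH[OF x(1,2)] a by (intro mult_left_mono) auto
      ultimately show ?thesis using step by (simp add: mult.assoc)
    qed
  qed
  moreover obtain m where "y < (3 / 2) ^ m"
    using real_arch_pow[of "3 / 2" y] by auto
  ultimately show ?thesis using y by (meson less_imp_le)
qed

section \<open>Independence under the privatized law\<close>

text \<open>The integral over the bind is an iterated one. The product rule applies first to the
  channel at fixed \<open>x\<close> and then to the sample, since the inner result is again a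
  product of functions of single coordinates. Taking \<open>g\<close> with values in
  \<open>ennreal\<close> avoids integrability conditions, and one common factor \<open>g\<close>
  suffices for the exponential of a sum.\<close>

lemma nn_integral_privatized_prod:
  fixes g :: "real \<Rightarrow> ennreal"
  assumes f: "f \<in> borel_measurable M" "sup_norm M f < \<infinity>" and \<alpha>: "0 < \<alpha>"
    and P: "P \<in> space (prob_algebra M)" and g[measurable]: "g \<in> borel_measurable borel"
  shows "(\<integral>\<^sup>+z. (\<Prod>i=1..n. g (z i)) \<partial>privatized M \<alpha> f n P) =
    (\<integral>\<^sup>+x. (\<integral>\<^sup>+z. g z \<partial>binary_channel M \<alpha> f x) \<partial>P) ^ n"
proof -
  have sP[measurable_cong]: "sets P = sets M" and pP: "prob_space P"
    using P by (auto simp: space_prob_algebra)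
  have "sets (Pi\<^sub>M {1..n} (\<lambda>_. P)) = sets (Pi\<^sub>M {1..n} (\<lambda>_. M))"
    by (intro sets_PiM_cong sP refl)
  then have Q: "product_channel M \<alpha> f n \<in>
      Pi\<^sub>M {1..n} (\<lambda>_. P) \<rightarrow>\<^sub>M subprob_algebra (Pi\<^sub>M {1..n} (\<lambda>_. borel))"
    using measurable_prob_algebraD[OF measurable_product_channel[OF f \<alpha>]]
    by (simp cong: measurable_cong_sets)
  have B[measurable]: "binary_channel M \<alpha> f \<in> P \<rightarrow>\<^sub>M subprob_algebra borel"
    using measurable_prob_algebraD[OF measurable_binary_channel[OF f \<alpha>]] sP
    by (simp cong: measurable_cong_sets)
  have inner: "(\<integral>\<^sup>+z. (\<Prod>i=1..n. g (z i)) \<partial>product_channel M \<alpha> f n x) =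
      (\<Prod>i=1..n. \<integral>\<^sup>+z. g z \<partial>binary_channel M \<alpha> f (x i))" for x
  proof -
    interpret product_prob_space "\<lambda>i. binary_channel M \<alpha> f (x i)" "{1..n}"
      by (rule product_prob_spaceI) (rule prob_space_binary_channel)
    show ?thesis unfolding product_channel_def
      by (rule product_nn_integral_prod) auto
  qed
  interpret P: product_prob_space "\<lambda>_. P" "{1..n}"
    by (rule product_prob_spaceI) (rule pP)
  have "(\<integral>\<^sup>+z. (\<Prod>i=1..n. g (z i)) \<partial>privatized M \<alpha> f n P) =
      (\<integral>\<^sup>+x. (\<integral>\<^sup>+z. (\<Prod>i=1..n. g (z i)) \<partial>product_channel M \<alpha> f n x) \<partial>Pi\<^sub>M {1..n} (\<lambda>_. P))"
    unfolding privatized_def by (rule nn_integral_bind[OF _ Q]) measurable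
  also have "\<dots> = (\<integral>\<^sup>+x. (\<Prod>i=1..n. \<integral>\<^sup>+z. g z \<partial>binary_channel M \<alpha> f (x i)) \<partial>Pi\<^sub>M {1..n} (\<lambda>_. P))"
    by (simp only: inner)
  also have "\<dots> = (\<Prod>i=1..n. \<integral>\<^sup>+x. (\<integral>\<^sup>+z. g z \<partial>binary_channel M \<alpha> f x) \<partial>P)"
    by (rule P.product_nn_integral_prod) (auto intro!: nn_integral_measurable_subprob_algebra2)
  finally show ?thesis by simp
qed

section \<open>Moment generating function of one privatized observation\<close>

text \<open>This is Hoeffding's lemma for the law on \<open>z\<close> and \<open>- z\<close> with
  mean \<open>m\<close>: the support has width \<open>2 * z\<close>, and
  \<open>c\<^sup>2 * (2 * z)\<^sup>2 / 8 = c\<^sup>2 * z\<^sup>2 / 2\<close>.\<close>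

lemma two_point_mgf_le:
  fixes m z c :: real
  assumes "0 < z" "\<bar>m\<bar> \<le> z"
  shows "(1 + m / z) / 2 * exp (c * z) + (1 - m / z) / 2 * exp (- (c * z))
    \<le> exp (c * m + c\<^sup>2 * z\<^sup>2 / 2)"
proof -
  have *: "(1 + m / z) / 2 * exp (c * z) + (1 - m / z) / 2 * exp (- (c * z))
    \<le> exp (c * m + c\<^sup>2 * z\<^sup>2 / 2)" if c: "0 \<le> c" and m: "\<bar>m\<bar> \<le> z" for c m
  proof -
    define p where "p = (1 + m / z) / 2"
    have "- 1 \<le> m / z" using m assms(1) by (simp add: field_simps abs_le_iff)
    then have p: "0 \<le> p" unfolding p_def by simp
    \<comment> \<open>Factoring \<open>exp (- (c * z))\<close> out of the moment generating function
      moves the support to 0 and \<open>2 * z\<close>; what remains is \<open>w\<close>, to which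
      the auxiliary inequality applies with \<open>h\<close> nonnegative.\<close>
    define h where "h = 2 * c * z"
    have h: "0 \<le> h" using c assms by (simp add: h_def)
    define w where "w = 1 + p * (exp h - 1)"
    have w: "0 < w" unfolding w_def using p h by (intro add_pos_nonneg mult_nonneg_nonneg) auto
    have "- h * p + ln (1 + p * (exp h - 1)) \<le> h\<^sup>2 / 8"
      by (rule Hoeffdings_lemma_aux) (use h p in auto)
    then have "ln w \<le> h * p + h\<^sup>2 / 8" by (simp add: w_def)
    then have "w \<le> exp (h * p + h\<^sup>2 / 8)" using w by (metis exp_le_cancel_iff exp_ln)
    then have "exp (- (c * z)) * w \<le> exp (- (c * z)) * exp (h * p + h\<^sup>2 / 8)" by simp
    also have "\<dots> = exp (c * m + c\<^sup>2 * z\<^sup>2 / 2)"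
      unfolding exp_add[symmetric] h_def p_def using assms(1)
      by (simp add: field_simps power2_eq_square)
    also have "exp (- (c * z)) * w = p * exp (c * z) + (1 - p) * exp (- (c * z))"
    proof -
      have "exp (- (c * z)) * exp h = exp (c * z)" unfolding exp_add[symmetric] h_def by simp
      then show ?thesis unfolding w_def by (simp add: algebra_simps)
    qed
    also have "1 - p = (1 - m / z) / 2" by (simp add: p_def field_simps)
    finally show ?thesis by (simp add: p_def)
  qed
  show ?thesis
  proof (cases "0 \<le> c")
    case True
    then show ?thesis using * assms(2) by blast
  next
    case False
    \<comment> \<open>Reflecting the law at 0 swaps the two summands and makes the parameter
      positive.\<close>
    then show ?thesis using *[of "- c" "- m"] assms(2) by (simp add: add.commute)
  qed
qed

lemma channel_level_nonneg: "0 < \<alpha> \<Longrightarrow> 0 \<le> channel_level M \<alpha> f"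
  unfolding channel_level_def by (intro mult_nonneg_nonneg divide_nonneg_nonneg) auto

lemma abs_le_channel_level:
  assumes "sup_norm M f < \<infinity>" "0 < \<alpha>" "x \<in> space M"
  shows "\<bar>f x\<bar> \<le> channel_level M \<alpha> f"
proof -
  have "enn2real (sup_norm M f) * 1 \<le> channel_level M \<alpha> f"
    unfolding channel_level_def using assms(2) by (intro mult_left_mono) auto
  then show ?thesis using abs_le_sup_norm[OF assms(1,3)] by linarith
qed

lemma nn_integral_binary_channel:
  fixes g :: "real \<Rightarrow> real"
  assumes "sup_norm M f < \<infinity>" "0 < \<alpha>" "x \<in> space M"
    and [measurable]: "g \<in> borel_measurable borel" and g: "\<And>y. 0 \<le> g y"
  defines "z\<^sub>0 \<equiv> channel_level M \<alpha> f"
  shows "(\<integral>\<^sup>+z. ennreal (g z) \<partial>binary_channel M \<alpha> f x) =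
    ennreal ((1 + f x / z\<^sub>0) / 2 * g z\<^sub>0 + (1 - f x / z\<^sub>0) / 2 * g (- z\<^sub>0))"
proof -
  let ?p = "(1 + f x / z\<^sub>0) / 2"
  have "\<bar>f x / z\<^sub>0\<bar> \<le> 1" unfolding z\<^sub>0_def by (rule channel_ratio_le_1[OF assms(1-3)])
  from abs_le_D1[OF this] abs_le_D2[OF this] have p: "0 \<le> ?p" "?p \<le> 1" by auto
  have "(\<integral>\<^sup>+z. ennreal (g z) \<partial>binary_channel M \<alpha> f x) =
      (\<integral>\<^sup>+b. ennreal (g (if b then z\<^sub>0 else - z\<^sub>0)) \<partial>measure_pmf (bernoulli_pmf ?p))"
    unfolding binary_channel_def Let_def z\<^sub>0_def[symmetric] by (simp add: nn_integral_distr)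
  also have "\<dots> = ennreal (g z\<^sub>0) * ennreal ?p + ennreal (g (- z\<^sub>0)) * ennreal (1 - ?p)"
    using p by (simp add: nn_integral_bernoulli_pmf)
  also have "\<dots> = ennreal (?p * g z\<^sub>0 + (1 - ?p) * g (- z\<^sub>0))"
    using p g by (simp only: ennreal_plus ennreal_mult mult_nonneg_nonneg diff_ge_0_iff_ge mult.commute)
  also have "1 - ?p = (1 - f x / z\<^sub>0) / 2" by (simp add: field_simps)
  finally show ?thesis .
qed

text \<open>Averaging the channel over \<open>P\<close> again gives a two-point law, now with mean
  equal to the expectation of \<open>f\<close>. Hence the variance term involves the channel level
  alone, with no extra contribution from the spread of \<open>f\<close> under
  \<open>P\<close>.\<close>

lemma binary_channel_mgf_le:
  assumes f: "f \<in> borel_measurable M" "sup_norm M f < \<infinity>" and \<alpha>: "0 < \<alpha>"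
    and P: "P \<in> space (prob_algebra M)"
  shows "(\<integral>\<^sup>+x. (\<integral>\<^sup>+z. ennreal (exp (c * z)) \<partial>binary_channel M \<alpha> f x) \<partial>P)
    \<le> ennreal (exp (c * (\<integral>x. f x \<partial>P) + c\<^sup>2 * (channel_level M \<alpha> f)\<^sup>2 / 2))"
proof -
  define z where "z = channel_level M \<alpha> f"
  have sP: "sets P = sets M" and "prob_space P"
    using P by (auto simp: space_prob_algebra)
  then interpret prob_space P by simp
  have sp: "space P = space M" using sP by (rule sets_eq_imp_space_eq)
  have fP[measurable]: "f \<in> borel_measurable P" using f(1) sP by (simp cong: measurable_cong_sets)
  have bound: "\<bar>f x\<bar> \<le> z" if "x \<in> space P" for x
    using abs_le_channel_level[OF f(2) \<alpha>] that sp by (simp add: z_def)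
  have int[simp]: "integrable P f"
    by (rule integrable_const_bound[where B = z]) (use bound in \<open>auto intro: AE_I2\<close>)
  have mean: "\<bar>expectation f\<bar> \<le> z"
  proof -
    have "\<bar>expectation f\<bar> \<le> expectation (\<lambda>x. \<bar>f x\<bar>)" by (rule integral_abs_bound)
    also have "\<dots> \<le> expectation (\<lambda>x. z)" by (rule integral_mono) (use bound in auto)
    finally show ?thesis by (simp add: prob_space)
  qed
  define G where "G = (\<lambda>y. (1 + y / z) / 2 * exp (c * z) + (1 - y / z) / 2 * exp (- (c * z)))"
  have Gpos: "0 \<le> G (f x)" if "x \<in> space P" for x
  proof -
    have "\<bar>f x / z\<bar> \<le> 1"
      using channel_ratio_le_1[OF f(2) \<alpha>] that sp by (simp add: z_def)
    from abs_le_D1[OF this] abs_le_D2[OF this] show ?thesis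
      unfolding G_def by (intro add_nonneg_nonneg mult_nonneg_nonneg) auto
  qed
  have "(\<integral>\<^sup>+x. (\<integral>\<^sup>+z. ennreal (exp (c * z)) \<partial>binary_channel M \<alpha> f x) \<partial>P) =
      (\<integral>\<^sup>+x. ennreal (G (f x)) \<partial>P)"
    by (intro nn_integral_cong) (simp add: nn_integral_binary_channel[OF f(2) \<alpha>] sp G_def z_def)
  also have "\<dots> = ennreal (expectation (\<lambda>x. G (f x)))"
  proof (rule nn_integral_eq_integral)
    show "integrable P (\<lambda>x. G (f x))" by (simp add: G_def)
    show "AE x in P. 0 \<le> G (f x)" using Gpos by (rule AE_I2)
  qed
  \<comment> \<open>\<open>G\<close> is affine, so the expectation passes inside.\<close>
  also have "expectation (\<lambda>x. G (f x)) = G (expectation f)"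
    by (simp add: G_def prob_space)
  also have "G (expectation f) \<le> exp (c * expectation f + c\<^sup>2 * z\<^sup>2 / 2)"
  \<comment> \<open>If \<open>z = 0\<close>, division by zero yields 0 and \<open>G\<close> is
    constantly 1, while \<open>mean\<close> forces the expectation to vanish; both sides are then
    1.\<close>
  proof (cases "z = 0")
    case True
    then show ?thesis using mean by (simp add: G_def)
  next
    case False
    then have "0 < z" using mean by linarith
    then show ?thesis unfolding G_def using mean by (rule two_point_mgf_le)
  qed
  finally show ?thesis by (simp add: z_def ennreal_leI)
qed

section \<open>Moment generating function of the arithmetic mean\<close>

text \<open>By independence the bound for one observation at parameter \<open>c / n\<close> is
  raised to the power \<open>n\<close>, so the exponent becomes \<open>n * (c / n)\<^sup>2\<close>
  times half the squared level.\<close>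

lemma privatized_mean_mgf_le:
  assumes f: "f \<in> borel_measurable M" "sup_norm M f < \<infinity>" and \<alpha>: "0 < \<alpha>"
    and P: "P \<in> space (prob_algebra M)" and n: "1 \<le> n"
  shows "(\<integral>\<^sup>+z. ennreal (exp (c * (arith_mean n z - (\<integral>x. f x \<partial>P)))) \<partial>privatized M \<alpha> f n P)
    \<le> ennreal (exp (c\<^sup>2 * (channel_level M \<alpha> f)\<^sup>2 / (2 * real n)))"
proof -
  define \<mu> where "\<mu> = (\<integral>x. f x \<partial>P)"
  let ?z = "channel_level M \<alpha> f"
  define d where "d = c / real n"
  have g: "(\<lambda>z. ennreal (exp (d * z) * exp (- (d * \<mu>)))) \<in> borel_measurable borel" by measurable
  have "ennreal (exp (c * (arith_mean n z - \<mu>))) =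
      (\<Prod>i=1..n. ennreal (exp (d * z i) * exp (- (d * \<mu>))))" for z
  proof -
    \<comment> \<open>The centring is spread evenly over the coordinates, so that the integrand is a
      product of \<open>n\<close> copies of one function.\<close>
    have "c * (arith_mean n z - \<mu>) = (\<Sum>i=1..n. d * z i + - (d * \<mu>))"
      using n by (simp add: arith_mean_def d_def sum_subtractf right_diff_distrib
          flip: sum_distrib_left sum_divide_distrib)
    then show ?thesis by (simp add: exp_sum prod_ennreal flip: exp_add)
  qed
  then have "(\<integral>\<^sup>+z. ennreal (exp (c * (arith_mean n z - \<mu>))) \<partial>privatized M \<alpha> f n P) =
      (\<integral>\<^sup>+x. (\<integral>\<^sup>+z. ennreal (exp (d * z) * exp (- (d * \<mu>))) \<partial>binary_channel M \<alpha> f x) \<partial>P) ^ n"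
    using nn_integral_privatized_prod[OF f \<alpha> P g] by simp
  also have "\<dots> \<le> ennreal (exp (d\<^sup>2 * ?z\<^sup>2 / 2)) ^ n"
  proof (rule power_mono)
    have B: "binary_channel M \<alpha> f \<in> P \<rightarrow>\<^sub>M subprob_algebra borel"
      using measurable_prob_algebraD[OF measurable_binary_channel[OF f \<alpha>]] P
      by (auto simp: space_prob_algebra cong: measurable_cong_sets)
    \<comment> \<open>The constant centring factor is pulled out; it then cancels the linear term
      \<open>d * \<mu>\<close> of the exponent exactly.\<close>
    have "(\<integral>\<^sup>+x. (\<integral>\<^sup>+z. ennreal (exp (d * z) * exp (- (d * \<mu>))) \<partial>binary_channel M \<alpha> f x) \<partial>P) =
        (\<integral>\<^sup>+x. (\<integral>\<^sup>+z. ennreal (exp (d * z)) \<partial>binary_channel M \<alpha> f x) \<partial>P) * ennreal (exp (- (d * \<mu>)))"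
      by (simp add: ennreal_mult nn_integral_multc nn_integral_measurable_subprob_algebra2[OF _ B])
    also have "\<dots> \<le> ennreal (exp (d * \<mu> + d\<^sup>2 * ?z\<^sup>2 / 2)) * ennreal (exp (- (d * \<mu>)))"
      unfolding \<mu>_def by (intro mult_right_mono binary_channel_mgf_le[OF f \<alpha> P]) simp
    also have "\<dots> = ennreal (exp (d\<^sup>2 * ?z\<^sup>2 / 2))"
      by (simp flip: ennreal_mult exp_add)
    finally show "(\<integral>\<^sup>+x. (\<integral>\<^sup>+z. ennreal (exp (d * z) * exp (- (d * \<mu>))) \<partial>binary_channel M \<alpha> f x) \<partial>P)
      \<le> ennreal (exp (d\<^sup>2 * ?z\<^sup>2 / 2))" .
  qed simp
  also have "\<dots> = ennreal (exp (c\<^sup>2 * ?z\<^sup>2 / (2 * real n)))"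
    using n by (simp add: d_def ennreal_power exp_of_nat_mult[symmetric] field_simps power2_eq_square)
  finally show ?thesis by (simp add: \<mu>_def)
qed

section \<open>Risk bound from bias and channel level\<close>

text \<open>In units of \<psi> the error is at most \<open>D\<close> plus the centred deviation. In
  the constant, \<open>exp (2 * ln a * D)\<close> comes from the bias, the other exponential from
  the deviation, \<open>a\<close> from the envelope, and 2 from the two signs of the
  deviation.\<close>

lemma privatized_risk_le:
  fixes l :: "real \<Rightarrow> real"
  assumes a: "1 < a" and l: "l \<in> {0..} \<rightarrow> {0..}" "mono_on {0..} l"
    and growth: "\<forall>u\<ge>0. l (3 / 2 * u) \<le> a * l u"
    and f: "f \<in> borel_measurable M" "sup_norm M f < \<infinity>" and \<alpha>: "0 < \<alpha>"
    and P: "P \<in> space (prob_algebra M)" and n: "1 \<le> n" and \<psi>: "0 < \<psi>"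
    and level: "channel_level M \<alpha> f \<le> D * sqrt (real n) * \<psi>"
    and bias: "\<bar>(\<integral>x. f x \<partial>P) - \<theta>\<bar> \<le> D * \<psi>"
  shows "(\<integral>\<^sup>+z. ennreal (l \<bar>arith_mean n z - \<theta>\<bar>) \<partial>privatized M \<alpha> f n P)
    \<le> ennreal (2 * a * exp (2 * ln a * D + 2 * (ln a)\<^sup>2 * D\<^sup>2) * l \<psi>)"
proof -
  define c where "c = 2 * ln a"
  define \<mu> where "\<mu> = (\<integral>x. f x \<partial>P)"
  define X where "X = (\<lambda>z. arith_mean n z - \<mu>)"
  define b where "b = a * exp (c * D) * l \<psi>"
  let ?Q = "privatized M \<alpha> f n P"
  have c: "0 < c" using a by (simp add: c_def)
  have l\<psi>: "0 \<le> l \<psi>" using l(1) \<psi> by auto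
  have b: "0 \<le> b" using a l\<psi> by (simp add: b_def)
  have pointwise: "l \<bar>arith_mean n z - \<theta>\<bar> \<le> b * (exp (c / \<psi> * X z) + exp (- c / \<psi> * X z))" for z
  proof -
    define y where "y = \<bar>arith_mean n z - \<theta>\<bar> / \<psi>"
    have "\<bar>arith_mean n z - \<theta>\<bar> \<le> \<bar>X z\<bar> + D * \<psi>" using bias by (simp add: X_def \<mu>_def)
    then have y: "0 \<le> y" "y \<le> D + \<bar>X z\<bar> / \<psi>" using \<psi> by (simp_all add: y_def field_simps)
    have "l \<bar>arith_mean n z - \<theta>\<bar> = l (y * \<psi>)" using \<psi> by (simp add: y_def)
    also have "\<dots> \<le> a * exp (c * y) * l \<psi>"
      unfolding c_def by (rule doubling_growth_exp[OF a l growth]) (use \<psi> y in auto)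
    also have "\<dots> \<le> a * exp (c * (D + \<bar>X z\<bar> / \<psi>)) * l \<psi>"
      using y a l\<psi> c by (intro mult_right_mono mult_left_mono) auto
    also have "\<dots> = b * exp (c / \<psi> * \<bar>X z\<bar>)"
      by (simp add: b_def distrib_left exp_add)
    \<comment> \<open>The left side equals one of the two summands on the right, and the other is
      positive.\<close>
    also have "exp (c / \<psi> * \<bar>X z\<bar>) \<le> exp (c / \<psi> * X z) + exp (- c / \<psi> * X z)"
      by (simp add: abs_if add_increasing add_increasing2)
    finally show ?thesis using b by (simp add: mult_left_mono)
  qed
  have mgf: "(\<integral>\<^sup>+z. ennreal (exp (e * X z)) \<partial>?Q) \<le> ennreal (exp (c\<^sup>2 * D\<^sup>2 / 2))"
    \<comment> \<open>Fixing only the square of \<open>e\<close> covers both signs at once.\<close>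
    if e: "e\<^sup>2 = (c / \<psi>)\<^sup>2" for e
  proof -
    let ?z = "channel_level M \<alpha> f"
    have "?z\<^sup>2 \<le> (D * sqrt (real n) * \<psi>)\<^sup>2"
      using level channel_level_nonneg[OF \<alpha>] by (intro power_mono) auto
    then have "e\<^sup>2 * ?z\<^sup>2 / (2 * real n) \<le> e\<^sup>2 * (D * sqrt (real n) * \<psi>)\<^sup>2 / (2 * real n)"
      by (intro divide_right_mono mult_left_mono) auto
    also have "\<dots> = c\<^sup>2 * D\<^sup>2 / 2"
      unfolding e using n \<psi> by (simp add: power_mult_distrib power_divide)
    finally have "ennreal (exp (e\<^sup>2 * ?z\<^sup>2 / (2 * real n))) \<le> ennreal (exp (c\<^sup>2 * D\<^sup>2 / 2))"
      by (intro ennreal_leI) simp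
    with privatized_mean_mgf_le[OF f \<alpha> P n, of e] show ?thesis
      unfolding X_def \<mu>_def by (rule order_trans)
  qed
  \<comment> \<open>The sets of a bind are those of the kernel's values once the base space is
    nonempty. This makes \<open>X\<close> measurable, so the dominating integral can be
    split.\<close>
  have sets_Q: "sets ?Q = sets (Pi\<^sub>M {1..n} (\<lambda>_. borel))"
  proof -
    have "prob_space (Pi\<^sub>M {1..n} (\<lambda>_. P))"
      using P by (intro prob_space_PiM) (auto simp: space_prob_algebra)
    then have "space (Pi\<^sub>M {1..n} (\<lambda>_. P)) \<noteq> {}" by (rule prob_space.not_empty)
    then show ?thesis
      unfolding privatized_def by (intro sets_bind sets_product_channel)
  qed
  have X[measurable]: "X \<in> borel_measurable ?Q"
    unfolding X_def arith_mean_def measurable_cong_sets[OF sets_Q refl] by measurable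
  have "(\<integral>\<^sup>+z. ennreal (l \<bar>arith_mean n z - \<theta>\<bar>) \<partial>?Q)
      \<le> (\<integral>\<^sup>+z. ennreal b * (ennreal (exp (c / \<psi> * X z)) + ennreal (exp (- c / \<psi> * X z))) \<partial>?Q)"
    using pointwise b
    by (intro nn_integral_mono) (simp add: ennreal_leI flip: ennreal_plus ennreal_mult)
  also have "\<dots> = ennreal b * ((\<integral>\<^sup>+z. ennreal (exp (c / \<psi> * X z)) \<partial>?Q)
      + (\<integral>\<^sup>+z. ennreal (exp (- c / \<psi> * X z)) \<partial>?Q))"
    by (subst nn_integral_cmult) (simp_all add: nn_integral_add)
  also have "\<dots> \<le> ennreal b * (ennreal (exp (c\<^sup>2 * D\<^sup>2 / 2)) + ennreal (exp (c\<^sup>2 * D\<^sup>2 / 2)))"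
    by (intro mult_left_mono add_mono mgf) (simp_all add: power_divide)
  also have "\<dots> = ennreal (2 * a * exp (2 * ln a * D + 2 * (ln a)\<^sup>2 * D\<^sup>2) * l \<psi>)"
    using b by (simp add: b_def c_def exp_add power2_eq_square mult_ac flip: ennreal_plus ennreal_mult)
  finally show ?thesis .
qed

section \<open>Bias and noise at the chosen bandwidth\<close>

lemma private_scale_pos: "0 < \<alpha> \<Longrightarrow> 1 \<le> n \<Longrightarrow> 0 < private_scale \<alpha> n"
  by (simp add: private_scale_def add_pos_pos)

text \<open>The exponent \<open>t j\<close> cancels the one in the bandwidth, so all
  \<open>k\<close> terms coincide and their average is the common value.\<close>

lemma bandwidth_bias:
  assumes "1 \<le> k" "t \<in> {1..k} \<rightarrow> {0<..}"
  shows "1 / real k * (\<Sum>j=1..k. bandwidth k t s \<alpha> n j powr t j) =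
    private_scale \<alpha> n powr (1 / (1 + exponent_ratio k t s))"
proof -
  have "bandwidth k t s \<alpha> n j powr t j = private_scale \<alpha> n powr (1 / (1 + exponent_ratio k t s))"
    if "j \<in> {1..k}" for j
  proof -
    have "0 < t j" using assms(2) that by auto
    then show ?thesis using that by (simp add: bandwidth_def powr_powr)
  qed
  then show ?thesis using assms(1) by simp
qed

text \<open>With \<open>S\<close> the private scale, the product is \<open>S\<close> to the power
  \<open>- r / (1 + r)\<close> and the channel factor is \<open>sqrt n * S\<close>; the exponents
  add up to \<open>1 / (1 + r)\<close>. After division by \<open>sqrt n\<close>, noise and bias thus
  have the same rate, which is the reason for this bandwidth.\<close>

lemma bandwidth_noise:
  assumes "t \<in> {1..k} \<rightarrow> {0<..}" "s \<in> {1..k} \<rightarrow> {0..}" "0 < \<alpha>" "1 \<le> n"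
  shows "(\<Prod>j=1..k. bandwidth k t s \<alpha> n j powr (- s j)) * ((exp \<alpha> + 1) / (exp \<alpha> - 1)) =
    sqrt (real n) * private_scale \<alpha> n powr (1 / (1 + exponent_ratio k t s))"
proof -
  define S where "S = private_scale \<alpha> n"
  define r where "r = exponent_ratio k t s"
  have S: "0 < S" unfolding S_def by (rule private_scale_pos[OF assms(3,4)])
  have r: "0 \<le> r" unfolding r_def exponent_ratio_def
    using assms(1,2) by (intro sum_nonneg divide_nonneg_nonneg) (force simp: Pi_iff less_imp_le)+
  have "(\<Prod>j=1..k. bandwidth k t s \<alpha> n j powr (- s j)) = (\<Prod>j=1..k. S powr (- (s j / t j) / (1 + r)))"
    by (intro prod.cong) (simp_all add: bandwidth_def powr_powr S_def r_def)
  also have "\<dots> = S powr (\<Sum>j=1..k. - (s j / t j) / (1 + r))"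
    using S by (simp add: powr_sum)
  also have "(\<Sum>j=1..k. - (s j / t j) / (1 + r)) = - r / (1 + r)"
    unfolding r_def exponent_ratio_def by (simp only: sum_negf flip: sum_divide_distrib)
  finally have "(\<Prod>j=1..k. bandwidth k t s \<alpha> n j powr (- s j)) = S powr (- r / (1 + r))" .
  moreover have "(exp \<alpha> + 1) / (exp \<alpha> - 1) = sqrt (real n) * S"
    using assms(4) by (simp add: S_def private_scale_def)
  moreover have "S powr (- r / (1 + r)) * S = S powr (1 / (1 + r))"
  proof -
    have "- r / (1 + r) + 1 = 1 / (1 + r)" using r by (simp add: field_simps)
    then show ?thesis using powr_add[of S "- r / (1 + r)" 1] S by simp
  qed
  ultimately show ?thesis by (simp add: S_def r_def mult_ac)
qed

section \<open>Uniform risk bound over the model\<close>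

text \<open>The constant is chosen before all other data, so it depends on \<open>a\<close> and
  \<open>D\<^sub>0\<close> only. The bandwidth is required to lie in the box up to
  \<open>h\<^sub>0\<close> because the norm and bias bounds are assumed only there.\<close>

theorem theorem5p2:
  fixes a D\<^sub>0 :: real
  assumes a: "1 < a" and D\<^sub>0: "0 < D\<^sub>0"
  shows "\<exists>C\<^sub>0::real. 0 < C\<^sub>0 \<and>
    (\<forall>(M :: 'x measure) (\<P> :: 'x measure set) (\<theta> :: 'x measure \<Rightarrow> real) (l :: real \<Rightarrow> real)
      (k :: nat) (t :: nat \<Rightarrow> real) (s :: nat \<Rightarrow> real) (h\<^sub>0 :: real)
      (ell :: (nat \<Rightarrow> real) \<Rightarrow> 'x \<Rightarrow> real) (\<alpha> :: real) (n :: nat).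
      \<P> \<subseteq> space (prob_algebra M) \<longrightarrow>
      l \<in> {0..} \<rightarrow> {0..} \<longrightarrow> mono_on {0..} l \<longrightarrow> l 0 = 0 \<longrightarrow>
      (\<forall>u\<ge>0. l (3 / 2 * u) \<le> a * l u) \<longrightarrow>
      1 \<le> k \<longrightarrow> t \<in> {1..k} \<rightarrow> {0<..} \<longrightarrow> s \<in> {1..k} \<rightarrow> {0..} \<longrightarrow> 0 < h\<^sub>0 \<longrightarrow> h\<^sub>0 \<le> 1 \<longrightarrow>
      (\<forall>h \<in> {1..k} \<rightarrow>\<^sub>E UNIV. ell h \<in> borel_measurable M) \<longrightarrow>
      (\<forall>h \<in> {1..k} \<rightarrow>\<^sub>E {0<..h\<^sub>0}.
         sup_norm M (ell h) \<le> ennreal (D\<^sub>0 * (\<Prod>j=1..k. h j powr (- s j))) \<and>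
         (SUP P\<in>\<P>. ennreal \<bar>(\<integral>x. ell h x \<partial>P) - \<theta> P\<bar>)
           \<le> ennreal (D\<^sub>0 * (1 / real k) * (\<Sum>j=1..k. h j powr t j))) \<longrightarrow>
      0 < \<alpha> \<longrightarrow> 1 \<le> n \<longrightarrow>
      bandwidth k t s \<alpha> n \<in> {1..k} \<rightarrow>\<^sub>E {0<..h\<^sub>0} \<longrightarrow>
      (SUP P\<in>\<P>. \<integral>\<^sup>+z. ennreal (l \<bar>arith_mean n z - \<theta> P\<bar>)
                    \<partial>privatized M \<alpha> (ell (bandwidth k t s \<alpha> n)) n P)
        \<le> ennreal (C\<^sub>0 * l (private_scale \<alpha> n powr (1 / (1 + exponent_ratio k t s)))))"
proof (intro exI conjI allI impI)
  show "0 < 2 * a * exp (2 * ln a * D\<^sub>0 + 2 * (ln a)\<^sup>2 * D\<^sub>0\<^sup>2)"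
    using a by simp
next
  fix M :: "'x measure" and \<P> :: "'x measure set" and \<theta> :: "'x measure \<Rightarrow> real"
    and l :: "real \<Rightarrow> real" and k :: nat and t s :: "nat \<Rightarrow> real" and h\<^sub>0 :: real
    and ell :: "(nat \<Rightarrow> real) \<Rightarrow> 'x \<Rightarrow> real" and \<alpha> :: real and n :: nat
  assume \<P>: "\<P> \<subseteq> space (prob_algebra M)"
    and l: "l \<in> {0..} \<rightarrow> {0..}" "mono_on {0..} l"
    and growth: "\<forall>u\<ge>0. l (3 / 2 * u) \<le> a * l u"
    and k: "1 \<le> k" and t: "t \<in> {1..k} \<rightarrow> {0<..}" and s: "s \<in> {1..k} \<rightarrow> {0..}"
    and meas: "\<forall>h \<in> {1..k} \<rightarrow>\<^sub>E UNIV. ell h \<in> borel_measurable M"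
    and bounds: "\<forall>h \<in> {1..k} \<rightarrow>\<^sub>E {0<..h\<^sub>0}.
         sup_norm M (ell h) \<le> ennreal (D\<^sub>0 * (\<Prod>j=1..k. h j powr (- s j))) \<and>
         (SUP P\<in>\<P>. ennreal \<bar>(\<integral>x. ell h x \<partial>P) - \<theta> P\<bar>)
           \<le> ennreal (D\<^sub>0 * (1 / real k) * (\<Sum>j=1..k. h j powr t j))"
    and \<alpha>: "0 < \<alpha>" and n: "1 \<le> n"
    and h: "bandwidth k t s \<alpha> n \<in> {1..k} \<rightarrow>\<^sub>E {0<..h\<^sub>0}"
  let ?h = "bandwidth k t s \<alpha> n"
  define f where "f = ell ?h"
  define \<psi> where "\<psi> = private_scale \<alpha> n powr (1 / (1 + exponent_ratio k t s))"
  have \<psi>: "0 < \<psi>" using private_scale_pos[OF \<alpha> n] by (simp add: \<psi>_def)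
  have "?h \<in> {1..k} \<rightarrow>\<^sub>E UNIV" using h by auto
  then have f: "f \<in> borel_measurable M" using meas by (simp add: f_def)
  let ?B = "D\<^sub>0 * (\<Prod>j=1..k. ?h j powr (- s j))"
  have norm: "sup_norm M f \<le> ennreal ?B" using bounds h by (simp add: f_def)
  then have fin: "sup_norm M f < \<infinity>" by (rule order_le_less_trans) simp
  \<comment> \<open>Multiplying this by the channel factor lets \<open>bandwidth_noise\<close>
    evaluate the level as \<open>D\<^sub>0 * sqrt n * \<psi>\<close>.\<close>
  have "enn2real (sup_norm M f) \<le> ?B"
    using norm D\<^sub>0 by (intro enn2real_leI mult_nonneg_nonneg prod_nonneg) auto
  then have "channel_level M \<alpha> f \<le> ?B * ((exp \<alpha> + 1) / (exp \<alpha> - 1))"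
    unfolding channel_level_def using \<alpha> by (intro mult_right_mono) auto
  also have "\<dots> = D\<^sub>0 * sqrt (real n) * \<psi>"
    unfolding mult.assoc bandwidth_noise[OF t s \<alpha> n] \<psi>_def ..
  finally have level: "channel_level M \<alpha> f \<le> D\<^sub>0 * sqrt (real n) * \<psi>" .
  have bias: "\<bar>(\<integral>x. f x \<partial>P) - \<theta> P\<bar> \<le> D\<^sub>0 * \<psi>" if "P \<in> \<P>" for P
  proof -
    have "ennreal \<bar>(\<integral>x. f x \<partial>P) - \<theta> P\<bar> \<le> (SUP P\<in>\<P>. ennreal \<bar>(\<integral>x. f x \<partial>P) - \<theta> P\<bar>)"
      using that by (rule SUP_upper)
    also have "\<dots> \<le> ennreal (D\<^sub>0 * (1 / real k * (\<Sum>j=1..k. ?h j powr t j)))"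
      using bounds h by (simp add: f_def mult.assoc)
    also have "\<dots> = ennreal (D\<^sub>0 * \<psi>)"
      unfolding bandwidth_bias[OF k t] \<psi>_def ..
    finally show ?thesis using D\<^sub>0 \<psi> by simp
  qed
  show "(SUP P\<in>\<P>. \<integral>\<^sup>+z. ennreal (l \<bar>arith_mean n z - \<theta> P\<bar>) \<partial>privatized M \<alpha> (ell ?h) n P)
    \<le> ennreal (2 * a * exp (2 * ln a * D\<^sub>0 + 2 * (ln a)\<^sup>2 * D\<^sub>0\<^sup>2)
        * l (private_scale \<alpha> n powr (1 / (1 + exponent_ratio k t s))))"
    unfolding f_def[symmetric] \<psi>_def[symmetric]
    by (intro SUP_least privatized_risk_le[OF a l growth f fin \<alpha> _ n \<psi> level bias])
      (use \<P> in auto)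
qed

end
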